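(* Let $K$ be an algebraically closed field of characteristic $\neq 2,3$, let $N$ and $k$ be positive integers, and let $F$ be a form of degree $3$ in the polynomial ring $R=K[x_1,\ldots,x_N]$. If $F$ is $2k$-strong, then there is a Zariski dense open subset of $\mathcal{D}F$ all of whose elements are $k$-strong. That is, the function $\mathfrak{K}_3(k)=2k$ is a key function for degree $3$ and characteristics different from $2$ and $3$.
   Context: $\mathcal{D}F$ is the $K$-vector space spanned by the partial derivatives $\partial F/\partial x_1,\ldots,\partial F/\partial x_N$. A form $F$ has a $k$-collapse if $F=\sum_{i=1}^{k}G_iH_i$, where each $G_i$ is a form of positive degree strictly less than $\deg F$ (or is $0$) and each $H_i$ is a form of degree $\deg F-\deg G_i$ (or is $0$). $F$ is $k$-strong if it has no $k$-collapse (so $0$ is not $k$-strong). A function $\mathfrak{K}_i$ is a key function for degree $i$ and a set $\mathcal{S}$ of characteristics if, independently of the algebraically closed field $K$ with characteristic in $\mathcal{S}$ and of the number of variables $N$, for any form $F$ of degree $i$ in $K[x_1,\ldots,x_N]$, if $F$ is $\mathfrak{K}_i(k)$-strong then the elements in a Zariski dense open subset of $\mathcal{D}F$ are $k$-strong. *)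

theory Defs
  imports
    "HOL-Library.Poly_Mapping"
    "HOL-Computational_Algebra.Polynomial"
    "HOL-Analysis.Abstract_Topology"
begin

text \<open>
  Polynomials in the variables \<open>x\<^sub>0, x\<^sub>1, \<dots>\<close> are finitely supported functions from exponent vectors to
  coefficients, with the convolution product of \<^theory>\<open>HOL-Library.Poly_Mapping\<close>. The ring
  \<open>K[x\<^sub>1, \<dots>, x\<^sub>N]\<close> is the set of those that only involve the variables with index below \<open>N\<close>.
\<close>

type_synonym 'a mpoly = "(nat \<Rightarrow>\<^sub>0 nat) \<Rightarrow>\<^sub>0 'a"

definition monom_degree :: "(nat \<Rightarrow>\<^sub>0 nat) \<Rightarrow> nat" where
  "monom_degree m = (\<Sum>i\<in>Poly_Mapping.keys m. Poly_Mapping.lookup m i)"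

text \<open>By convention the zero polynomial gets total degree \<open>0\<close>.\<close>

definition total_degree :: "'a::zero mpoly \<Rightarrow> nat" where
  "total_degree F = Max (insert 0 (monom_degree ` Poly_Mapping.keys F))"

definition polys :: "nat \<Rightarrow> 'a::zero mpoly set" where
  "polys N = {F. \<forall>m\<in>Poly_Mapping.keys F. Poly_Mapping.keys m \<subseteq> {..<N}}"

text \<open>\<open>forms N d\<close> is the homogeneous component of degree \<open>d\<close>; as such it contains \<open>0\<close>.\<close>

definition forms :: "nat \<Rightarrow> nat \<Rightarrow> 'a::zero mpoly set" where
  "forms N d = {F \<in> polys N. \<forall>m\<in>Poly_Mapping.keys F. monom_degree m = d}"

text \<open>
  The exponent subtraction is truncated, but it only truncates where the coefficient
  \<open>of_nat (lookup m i)\<close> vanishes.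
\<close>

definition partial_deriv :: "nat \<Rightarrow> 'a::comm_ring_1 mpoly \<Rightarrow> 'a mpoly" where
  "partial_deriv i F =
     (\<Sum>m\<in>Poly_Mapping.keys F.
        Poly_Mapping.single (m - Poly_Mapping.single i 1)
          (of_nat (Poly_Mapping.lookup m i) * Poly_Mapping.lookup F m))"

definition mscale :: "'a::comm_ring_1 \<Rightarrow> 'a mpoly \<Rightarrow> 'a mpoly" where
  "mscale c F = Poly_Mapping.single 0 c * F"

interpretation mpoly: vector_space "mscale :: 'a::field \<Rightarrow> 'a mpoly \<Rightarrow> 'a mpoly"
proof
  fix a b :: 'a and x y :: "'a mpoly"
  show "mscale a (x + y) = mscale a x + mscale a y"
    by (simp add: mscale_def distrib_left)
  show "mscale (a + b) x = mscale a x + mscale b x"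
    by (simp add: mscale_def single_add distrib_right)
  show "mscale a (mscale b x) = mscale (a * b) x"
    by (simp add: mscale_def mult_single flip: mult.assoc)
  show "mscale 1 x = x"
    by (simp add: mscale_def)
qed

definition deriv_space :: "nat \<Rightarrow> 'a::field mpoly \<Rightarrow> 'a mpoly set" where
  "deriv_space N F = mpoly.span ((\<lambda>i. partial_deriv i F) ` {..<N})"

text \<open>
  In a \<open>k\<close>-collapse \<open>F = \<Sum> G\<^sub>i H\<^sub>i\<close>, the condition on \<open>H\<^sub>i\<close> allows \<open>H\<^sub>i = 0\<close> because \<open>0\<close> is a form of
  every degree. In particular \<open>F = 0\<close> has a \<open>k\<close>-collapse for every \<open>k\<close>, with all \<open>G\<^sub>i\<close> and \<open>H\<^sub>i\<close> zero.
\<close>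

definition has_collapse :: "nat \<Rightarrow> nat \<Rightarrow> 'a::comm_ring_1 mpoly \<Rightarrow> bool" where
  "has_collapse N k F \<longleftrightarrow>
     (\<exists>G H. F = (\<Sum>i<k. G i * H i) \<and>
        (\<forall>i<k.
           (G i = 0 \<or>
              G i \<in> forms N (total_degree (G i)) \<and>
              0 < total_degree (G i) \<and> total_degree (G i) < total_degree F) \<and>
           H i \<in> forms N (total_degree F - total_degree (G i))))"

definition strong :: "nat \<Rightarrow> nat \<Rightarrow> 'a::comm_ring_1 mpoly \<Rightarrow> bool" where
  "strong N k F \<longleftrightarrow> \<not> has_collapse N k F"

text \<open>
  The Zariski topology on a finite-dimensional vector space \<open>V\<close>, without a choice of coordinates:
  polynomial functions on \<open>V\<close> are generated by the constants and the linear functionals on \<open>V\<close>,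
  and closed sets are common zero sets of polynomial functions. Functions are only constrained on
  \<open>V\<close>; their values elsewhere play no role.
\<close>

inductive_set polynomial_functions :: "'a::field mpoly set \<Rightarrow> ('a mpoly \<Rightarrow> 'a) set"
  for V :: "'a mpoly set" where
  const: "(\<lambda>_. c) \<in> polynomial_functions V"
| linear:
    "\<lbrakk>\<And>u v. u \<in> V \<Longrightarrow> v \<in> V \<Longrightarrow> f (u + v) = f u + f v;
      \<And>c v. v \<in> V \<Longrightarrow> f (mscale c v) = c * f v\<rbrakk> \<Longrightarrow> f \<in> polynomial_functions V"
| add: "f \<in> polynomial_functions V \<Longrightarrow> g \<in> polynomial_functions V \<Longrightarrow>
    (\<lambda>v. f v + g v) \<in> polynomial_functions V"
| mult: "f \<in> polynomial_functions V \<Longrightarrow> g \<in> polynomial_functions V \<Longrightarrow>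
    (\<lambda>v. f v * g v) \<in> polynomial_functions V"

definition zariski_closed :: "'a::field mpoly set \<Rightarrow> 'a mpoly set \<Rightarrow> bool" where
  "zariski_closed V Z \<longleftrightarrow>
     (\<exists>P \<subseteq> polynomial_functions V. Z = {v \<in> V. \<forall>f\<in>P. f v = 0})"

definition zariski_topology :: "'a::field mpoly set \<Rightarrow> 'a mpoly topology" where
  "zariski_topology V = topology (\<lambda>U. U \<subseteq> V \<and> zariski_closed V (V - U))"

lemma istopology_zariski: "istopology (\<lambda>U. U \<subseteq> V \<and> zariski_closed V (V - U))"
  unfolding istopology_def
proof (intro conjI allI impI)
  fix S T assume S: "S \<subseteq> V \<and> zariski_closed V (V - S)" and T: "T \<subseteq> V \<and> zariski_closed V (V - T)"
  show "S \<inter> T \<subseteq> V" using S by auto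
  from S obtain P where P: "P \<subseteq> polynomial_functions V" "V - S = {v \<in> V. \<forall>f\<in>P. f v = 0}"
    unfolding zariski_closed_def by (elim conjE exE)
  from T obtain Q where Q: "Q \<subseteq> polynomial_functions V" "V - T = {v \<in> V. \<forall>f\<in>Q. f v = 0}"
    unfolding zariski_closed_def by (elim conjE exE)
  have S_iff: "v \<notin> S \<longleftrightarrow> (\<forall>f\<in>P. f v = 0)" and T_iff: "v \<notin> T \<longleftrightarrow> (\<forall>f\<in>Q. f v = 0)"
    if "v \<in> V" for v
    using that eqset_imp_iff[OF P(2), of v] eqset_imp_iff[OF Q(2), of v] by simp_all
  define R where "R = (\<lambda>(f, g) v. f v * g v) ` (P \<times> Q)"
  have "R \<subseteq> polynomial_functions V"
    using P(1) Q(1) unfolding R_def by (auto intro: polynomial_functions.mult)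
  moreover have "V - S \<inter> T = {v \<in> V. \<forall>h\<in>R. h v = 0}"
  proof (rule set_eqI)
    fix v
    have "(\<forall>h\<in>R. h v = 0) \<longleftrightarrow> (\<forall>f\<in>P. f v = 0) \<or> (\<forall>g\<in>Q. g v = 0)"
      unfolding R_def by auto
    then show "v \<in> V - S \<inter> T \<longleftrightarrow> v \<in> {v \<in> V. \<forall>h\<in>R. h v = 0}"
      using S_iff T_iff by (cases "v \<in> V") simp_all
  qed
  ultimately show "zariski_closed V (V - S \<inter> T)"
    unfolding zariski_closed_def by (intro exI[of _ R] conjI)
next
  fix \<U> assume U: "\<forall>U\<in>\<U>. U \<subseteq> V \<and> zariski_closed V (V - U)"
  show "\<Union>\<U> \<subseteq> V" using U by auto
  have "\<forall>U\<in>\<U>. \<exists>P. P \<subseteq> polynomial_functions V \<and> V - U = {v \<in> V. \<forall>f\<in>P. f v = 0}"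
    using U unfolding zariski_closed_def by simp
  from bchoice[OF this] obtain P where
    P: "\<forall>U\<in>\<U>. P U \<subseteq> polynomial_functions V \<and> V - U = {v \<in> V. \<forall>f\<in>P U. f v = 0}"
    by (elim exE)
  have U_iff: "v \<notin> U \<longleftrightarrow> (\<forall>f\<in>P U. f v = 0)" if "v \<in> V" "U \<in> \<U>" for v U
    using that eqset_imp_iff[OF conjunct2[OF bspec[OF P that(2)]], of v] by simp
  have "V - \<Union>\<U> = {v \<in> V. \<forall>f\<in>\<Union>(P ` \<U>). f v = 0}"
  proof (rule set_eqI)
    fix v
    show "v \<in> V - \<Union>\<U> \<longleftrightarrow> v \<in> {v \<in> V. \<forall>f\<in>\<Union>(P ` \<U>). f v = 0}"
      using U_iff by (cases "v \<in> V") simp_all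
  qed
  moreover have "\<Union>(P ` \<U>) \<subseteq> polynomial_functions V"
    using P by (simp add: UN_subset_iff)
  ultimately show "zariski_closed V (V - \<Union>\<U>)"
    unfolding zariski_closed_def by (intro exI[of _ "\<Union>(P ` \<U>)"] conjI)
qed

lemma openin_zariski:
  "openin (zariski_topology V) U \<longleftrightarrow> U \<subseteq> V \<and> zariski_closed V (V - U)"
  by (simp add: zariski_topology_def istopology_zariski)

lemma topspace_zariski: "topspace (zariski_topology V) = V"
proof -
  have "zariski_closed V (V - V)"
    unfolding zariski_closed_def
    by (rule exI[of _ "{\<lambda>_. 1}"]) (auto intro: polynomial_functions.const)
  then have "openin (zariski_topology V) V" by (simp add: openin_zariski)
  moreover have "topspace (zariski_topology V) \<subseteq> V"
    using openin_topspace openin_zariski by blast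
  ultimately show ?thesis
    by (simp add: openin_subset subset_antisym)
qed

definition generically_strong :: "nat \<Rightarrow> nat \<Rightarrow> 'a::field mpoly \<Rightarrow> bool" where
  "generically_strong N k F \<longleftrightarrow>
     (\<exists>U. openin (zariski_topology (deriv_space N F)) U \<and>
          zariski_topology (deriv_space N F) closure_of U = deriv_space N F \<and>
          (\<forall>Q\<in>U. strong N k Q))"

text \<open>
  Quantification over all algebraically closed fields is not possible inside a formula. The field is
  therefore a type parameter, and \<open>\<kappa>\<close> is a key function if this predicate holds for all \<open>'a\<close>. The set
  of characteristics must be given as a set of natural numbers, \<open>0\<close> being allowed.
\<close>

definition key_function ::
  "'a::alg_closed_field itself \<Rightarrow> nat \<Rightarrow> nat set \<Rightarrow> (nat \<Rightarrow> nat) \<Rightarrow> bool" where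
  "key_function _ d S \<kappa> \<longleftrightarrow>
     (CHAR('a) \<in> S \<longrightarrow>
       (\<forall>N>0. \<forall>k>0. \<forall>F\<in>(forms N d :: 'a mpoly set).
          strong N (\<kappa> k) F \<longrightarrow> generically_strong N k F))"

end

theory Submission
  imports Defs "Jordan_Normal_Form.Determinant"
begin

text \<open>
  A quadric with a \<open>k\<close>-collapse has a Hessian matrix of rank at most \<open>2k\<close>, because a product of two
  linear forms contributes two matrices of rank one (lemma \<open>collapse_gram_minor_zero\<close>). So every
  point of \<open>\<D>F\<close> at which some fixed minor of order \<open>2k + 1\<close> is nonzero is \<open>k\<close>-strong. Such a set is
  open, and it is dense as soon as it is nonempty, since the vector space \<open>\<D>F\<close> over an infinite
  field is irreducible (lemma \<open>dense_zariski_nonvanishing\<close>).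

  It remains to find a minor of order \<open>2k + 1\<close> that does not vanish identically on \<open>\<D>F\<close>. Suppose
  there is none, so all members of \<open>\<D>F\<close> have rank at most \<open>2k\<close>. Let \<open>Q\<^sub>0\<close> be a member of maximal
  rank \<open>r \<le> 2k\<close>, with kernel \<open>W\<close>. The rank of \<open>Q\<^sub>0 + t Q\<close> stays at most \<open>r\<close> for all \<open>t\<close>, and to
  first order in \<open>t\<close> this forces \<open>Q\<close> to vanish on \<open>W\<close> (lemma
  \<open>bounded_rank_vanishes_on_kernel\<close>). Hence all of \<open>\<D>F\<close> vanishes on \<open>W\<close>, which is the zero set of
  \<open>r\<close> linear forms; in other words, all partial derivatives of \<open>F\<close> lie in the ideal generated by
  these linear forms (lemma \<open>isotropic_projection_quadric\<close>). By Euler's identity the cubic \<open>F\<close> lies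
  in it too, and this is a \<open>2k\<close>-collapse of \<open>F\<close>. The primes 2 and 3 have to be invertible in order
  to recover a quadric from its Hessian matrix and a cubic from its partial derivatives.
\<close>

section \<open>Determinants and polynomials over infinite fields\<close>

abbreviation fdet :: "nat \<Rightarrow> (nat \<Rightarrow> nat \<Rightarrow> 'a::comm_ring_1) \<Rightarrow> 'a" where
  "fdet n f \<equiv> det (mat n n (\<lambda>(i, j). f i j))"

lemma fdet_Leibniz:
  "fdet n f = (\<Sum>p | p permutes {0..<n}. signof p * (\<Prod>i = 0..<n. f i (p i)))"
proof -
  have "(\<Prod>i = 0..<n. mat n n (\<lambda>(i, j). f i j) $$ (i, p i)) = (\<Prod>i = 0..<n. f i (p i))"
    if "p permutes {0..<n}" for p
    using permutes_in_image[OF that] by (intro prod.cong) auto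
  then show ?thesis by (simp add: det_def)
qed

lemma fdet_cong:
  assumes "\<And>i j. i < n \<Longrightarrow> j < n \<Longrightarrow> f i j = g i j"
  shows "fdet n f = fdet n g"
  by (rule arg_cong[of _ _ det], rule eq_matI) (use assms in auto)

lemma fdet_last_column_zero:
  fixes f :: "nat \<Rightarrow> nat \<Rightarrow> 'a::idom"
  assumes "\<And>i. i < n \<Longrightarrow> f i n = 0"
  shows "fdet (Suc n) f = fdet n f * f n n"
proof -
  let ?A = "mat n n (\<lambda>(i, j). f i j)" and ?C = "mat 1 n (\<lambda>(i, j). f n j)"
    and ?D = "mat 1 1 (\<lambda>(i, j). f n n)"
  have "mat (Suc n) (Suc n) (\<lambda>(i, j). f i j) = four_block_mat ?A (0\<^sub>m n 1) ?C ?D"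
    by (rule eq_matI) (use assms in \<open>auto simp: less_Suc_eq\<close>)
  moreover have "det (four_block_mat ?A (0\<^sub>m n 1) ?C ?D) = det ?A * det ?D"
    by (rule det_four_block_mat_upper_right_zero_col) auto
  moreover have "det ?D = f n n" by (subst det_single[of ?D]) auto
  ultimately show ?thesis by simp
qed

lemma fdet_last_row_zero:
  fixes f :: "nat \<Rightarrow> nat \<Rightarrow> 'a::idom"
  assumes "\<And>j. j < n \<Longrightarrow> f n j = 0"
  shows "fdet (Suc n) f = fdet n f * f n n"
proof -
  have T: "fdet m f = fdet m (\<lambda>i j. f j i)" for m
  proof -
    have "transpose_mat (mat m m (\<lambda>(i, j). f i j)) = mat m m (\<lambda>(i, j). f j i)"
      by (rule eq_matI) auto
    then show ?thesis using det_transpose[of "mat m m (\<lambda>(i, j). f i j)" m] by simp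
  qed
  show ?thesis unfolding T using fdet_last_column_zero[of n "\<lambda>i j. f j i"] assms by simp
qed

text \<open>
  The matrix is a product of an \<open>m \<times> n\<close> and an \<open>n \<times> m\<close> matrix. Padding both with zeros
  to size \<open>m \<times> m\<close> makes the determinant multiplicative, and the padded right factor has a zero
  row.
\<close>

lemma fdet_low_rank:
  fixes g h :: "nat \<Rightarrow> nat \<Rightarrow> 'a::idom"
  assumes "n < m"
  shows "fdet m (\<lambda>i j. \<Sum>s<n. g s i * h s j) = 0"
proof -
  let ?G = "mat m m (\<lambda>(i, s). if s < n then g s i else 0)"
    and ?H = "mat m m (\<lambda>(s, j). if s < n then h s j else 0)"
  have "(\<Sum>s = 0..<m. (if s < n then g s i else 0) * (if s < n then h s j else 0)) =
    (\<Sum>s<n. g s i * h s j)" for i j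
    using assms by (intro sum.mono_neutral_cong_right) auto
  then have "mat m m (\<lambda>(i, j). \<Sum>s<n. g s i * h s j) = ?G * ?H"
    by (intro eq_matI) (auto simp: scalar_prod_def)
  moreover have "det ?H = 0"
    unfolding fdet_Leibniz using assms by (auto intro!: sum.neutral prod_zero bexI[of _ n])
  ultimately show ?thesis using det_mult[of ?G m ?H] by simp
qed

text \<open>
  The polynomial is the Leibniz formula for the matrix of the linear polynomials
  \<open>a\<^sub>i\<^sub>j + b\<^sub>i\<^sub>j X\<close>.
\<close>

lemma fdet_pencil_poly:
  fixes a b :: "nat \<Rightarrow> nat \<Rightarrow> 'a::comm_ring_1"
  shows "\<exists>p. \<forall>t. fdet n (\<lambda>i j. a i j + t * b i j) = poly p t"
proof (intro exI allI)
  fix t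
  show "fdet n (\<lambda>i j. a i j + t * b i j) =
    poly (\<Sum>p | p permutes {0..<n}. [:signof p:] * (\<Prod>i = 0..<n. [:a i (p i), b i (p i):])) t"
    by (simp add: fdet_Leibniz poly_sum poly_prod)
qed

text \<open>
  Over a finite field \<open>\<Prod>\<^sub>a (X - a) + 1\<close> has the constant value \<open>1\<close> and hence no root.
\<close>

lemma infinite_alg_closed: "infinite (UNIV :: 'a::alg_closed_field set)"
proof
  assume fin: "finite (UNIV :: 'a set)"
  let ?p = "(\<Prod>a\<in>(UNIV :: 'a set). [:-a, 1:]) + 1"
  have "degree (\<Prod>a\<in>(UNIV :: 'a set). [:-a, 1:]) = card (UNIV :: 'a set)"
    by (subst degree_prod_eq_sum_degree) auto
  moreover have "card (UNIV :: 'a set) > 0" using fin by (simp add: card_gt_0_iff)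
  ultimately have "degree ?p > 0" by (subst degree_add_eq_left) auto
  then obtain x where "poly ?p x = 0" using alg_closed_imp_poly_has_root by blast
  then have "(\<Prod>a\<in>(UNIV :: 'a set). x - a) + 1 = 0" by (simp add: poly_prod)
  moreover have "(\<Prod>a\<in>(UNIV :: 'a set). x - a) = 0" using fin by (auto intro!: prod_zero)
  ultimately show False by simp
qed

lemma poly_eq_0_if_almost_all_roots:
  fixes p :: "'a::idom poly"
  assumes "infinite (UNIV :: 'a set)" "finite B" "\<And>t. t \<notin> B \<Longrightarrow> poly p t = 0"
  shows "p = 0"
proof (rule ccontr)
  assume "p \<noteq> 0"
  then have "finite {t. poly p t = 0}" by (rule poly_roots_finite)
  moreover have "UNIV \<subseteq> {t. poly p t = 0} \<union> B" using assms(3) by auto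
  ultimately show False using assms(1,2) by (meson finite_UnI finite_subset)
qed

section \<open>Linear spaces of symmetric matrices of bounded rank\<close>

definition bilin :: "nat \<Rightarrow> (nat \<Rightarrow> nat \<Rightarrow> 'a::comm_ring_1) \<Rightarrow> (nat \<Rightarrow> 'a) \<Rightarrow> (nat \<Rightarrow> 'a) \<Rightarrow> 'a" where
  "bilin N M x y = (\<Sum>a<N. \<Sum>b<N. M a b * x a * y b)"

lemma bilin_commute:
  assumes "\<And>a b. M a b = M b a"
  shows "bilin N M x y = bilin N M y x"
  unfolding bilin_def by (subst sum.swap) (simp add: assms ac_simps)

lemma bilin_add_matrix: "bilin N (\<lambda>a b. A a b + t * B a b) x y = bilin N A x y + t * bilin N B x y"
  by (simp add: bilin_def sum.distrib sum_distrib_left algebra_simps)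

lemma bilin_scale_right: "bilin N M x (\<lambda>a. c * y a) = c * bilin N M x y"
  by (simp add: bilin_def sum_distrib_left algebra_simps)

lemma bilin_diff_right: "bilin N M x (\<lambda>a. y a - z a) = bilin N M x y - bilin N M x z"
  by (simp add: bilin_def sum_subtractf algebra_simps)

lemma bilin_sum_right: "bilin N M x (\<lambda>a. \<Sum>j\<in>J. y j a) = (\<Sum>j\<in>J. bilin N M x (y j))"
  unfolding bilin_def sum_distrib_left
  by (subst sum.swap[of _ _ J], rule sum.cong[OF refl], subst sum.swap[of _ _ J]) simp

text \<open>
  Minors are taken along arbitrary vectors \<open>u\<^sub>i\<close>, \<open>v\<^sub>j\<close> and not only along rows and columns,
  so that a minor can be bordered by kernel vectors without a change of coordinates.
\<close>

abbreviation gram_minor :: "nat \<Rightarrow> (nat \<Rightarrow> nat \<Rightarrow> 'a::comm_ring_1) \<Rightarrow>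
    nat \<Rightarrow> (nat \<Rightarrow> nat \<Rightarrow> 'a) \<Rightarrow> (nat \<Rightarrow> nat \<Rightarrow> 'a) \<Rightarrow> 'a" where
  "gram_minor N M n u v \<equiv> fdet n (\<lambda>i j. bilin N M (u i) (v j))"

text \<open>
  Bordering the nonzero minor with \<open>y\<close> and \<open>w\<close> gives a vanishing minor whose last column is
  zero except for the corner entry, so the corner entry is zero.
\<close>

lemma kernel_of_maximal_minor:
  fixes M :: "nat \<Rightarrow> nat \<Rightarrow> 'a::idom"
  assumes "gram_minor N M r u v \<noteq> 0"
    and "\<And>u v. gram_minor N M (Suc r) u v = 0"
    and "\<And>i. i < r \<Longrightarrow> bilin N M (u i) w = 0"
  shows "bilin N M y w = 0"
proof -
  let ?u = "u(r := y)" and ?v = "v(r := w)"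
  have "0 = gram_minor N M (Suc r) ?u ?v" using assms(2) by simp
  also have "\<dots> = gram_minor N M r ?u ?v * bilin N M (?u r) (?v r)"
    by (rule fdet_last_column_zero) (use assms(3) in auto)
  also have "gram_minor N M r ?u ?v = gram_minor N M r u v"
    by (rule fdet_cong) auto
  finally show ?thesis using assms(1) by simp
qed

text \<open>
  This is the first-order part of the rank condition: the rank of \<open>M + t A\<close> cannot exceed
  the rank of \<open>M\<close>, so the tangent direction \<open>A\<close> must vanish on the kernel of \<open>M\<close> as a
  bilinear form. Border the nonzero
  minor of \<open>M\<close> with \<open>y\<close> and \<open>w\<close>. For \<open>M + t A\<close> the last column of the bordered minor is divisible
  by \<open>t\<close>. After division, the determinant is a polynomial in \<open>t\<close> that vanishes for all \<open>t \<noteq> 0\<close>,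
  hence also for \<open>t = 0\<close>, where it is the product of the minor of \<open>M\<close> and \<open>A(y, w)\<close>.
\<close>

lemma bounded_rank_vanishes_on_kernel:
  fixes M A :: "nat \<Rightarrow> nat \<Rightarrow> 'a::field"
  assumes inf: "infinite (UNIV :: 'a set)"
    and sym: "\<And>a b. M a b = M b a"
    and minor: "gram_minor N M r u v \<noteq> 0"
    and pencil: "\<And>t u v. gram_minor N (\<lambda>a b. M a b + t * A a b) (Suc r) u v = 0"
    and y: "\<And>x. bilin N M x y = 0" and w: "\<And>x. bilin N M x w = 0"
  shows "bilin N A y w = 0"
proof -
  have y': "bilin N M y x = 0" for x using y bilin_commute[of M, OF sym] by metis
  \<comment> \<open>The bordered minor of \<open>M + t A\<close> along \<open>y\<close> and \<open>w / t\<close> has the entries \<open>a\<^sub>i\<^sub>j + t b\<^sub>i\<^sub>j\<close>.\<close>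
  define a where "a i j = (if j = r then (if i = r then bilin N A y w else bilin N A (u i) w)
    else if i = r then 0 else bilin N M (u i) (v j))" for i j
  define b where "b i j = (if j = r then 0 else bilin N A ((u(r := y)) i) (v j))" for i j
  obtain p where p: "\<And>t. fdet (Suc r) (\<lambda>i j. a i j + t * b i j) = poly p t"
    using fdet_pencil_poly[of "Suc r" a b] by blast
  have "poly p t = 0" if "t \<noteq> 0" for t
  proof -
    \<comment> \<open>Using \<open>w / t\<close> as the last vector divides the last column by \<open>t\<close>.\<close>
    have "0 = gram_minor N (\<lambda>a b. M a b + t * A a b) (Suc r) (u(r := y))
        (v(r := (\<lambda>c. inverse t * w c)))"
      using pencil by simp
    also have "\<dots> = fdet (Suc r) (\<lambda>i j. a i j + t * b i j)"
      by (rule fdet_cong)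
        (use that in \<open>auto simp: a_def b_def bilin_add_matrix bilin_scale_right w y'\<close>)
    finally show ?thesis using p by simp
  qed
  then have "p = 0" using poly_eq_0_if_almost_all_roots[of "{0}" p] inf by auto
  then have "0 = fdet (Suc r) a" using p[of 0] by simp
  also have "\<dots> = fdet r a * a r r"
    by (rule fdet_last_row_zero) (simp add: a_def)
  also have "fdet r a = gram_minor N M r u v"
    by (rule fdet_cong) (simp add: a_def)
  finally show ?thesis using minor by (simp add: a_def)
qed

text \<open>
  A linear space of symmetric matrices of rank at most \<open>n\<close> vanishes on a common subspace of
  codimension at most \<open>n\<close>: the kernel \<open>W\<close> of a member of maximal rank \<open>r\<close>. The subspace is
  presented by a projection onto it, which is the form needed for substitution into polynomials:
  \<open>P c\<close> is the image of the \<open>c\<close>-th standard basis vector under the map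
  \<open>x \<mapsto> x - \<Sum>\<^sub>j l\<^sub>j(x) v\<^sub>j\<close>, so it differs from the identity by only \<open>r\<close> linear forms.
\<close>

lemma bounded_rank_common_isotropic_projection:
  fixes S :: "(nat \<Rightarrow> nat \<Rightarrow> 'a::field) set"
  assumes inf: "infinite (UNIV :: 'a set)" and ne: "S \<noteq> {}"
    and sym: "\<And>M a b. M \<in> S \<Longrightarrow> M a b = M b a"
    and line: "\<And>M A t. M \<in> S \<Longrightarrow> A \<in> S \<Longrightarrow> (\<lambda>a b. M a b + t * A a b) \<in> S"
    and minors: "\<And>M u v. M \<in> S \<Longrightarrow> gram_minor N M (Suc n) u v = 0"
  shows "\<exists>r\<le>n. \<exists>v l P. (\<forall>a c. P c a = (if a = c then 1 else 0) - (\<Sum>j<r. l j c * v j a)) \<and>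
    (\<forall>A\<in>S. \<forall>c<N. \<forall>d<N. bilin N A (P c) (P d) = 0)"
proof -
  define r where "r = (LEAST r. \<forall>M\<in>S. \<forall>u v. gram_minor N M (Suc r) u v = 0)"
  have "\<forall>M\<in>S. \<forall>u v. gram_minor N M (Suc n) u v = 0" using minors by blast
  then have r: "\<forall>M\<in>S. \<forall>u v. gram_minor N M (Suc r) u v = 0" and "r \<le> n"
    unfolding r_def by (rule LeastI, rule Least_le)
  have "\<exists>M\<in>S. \<exists>u v. gram_minor N M r u v \<noteq> 0"
  proof (cases r)
    case 0
    then show ?thesis using ne by auto
  next
    case (Suc r')
    then have "r' < (LEAST r. \<forall>M\<in>S. \<forall>u v. gram_minor N M (Suc r) u v = 0)"
      unfolding r_def by simp
    from not_less_Least[OF this] have "\<exists>M\<in>S. \<exists>u v. gram_minor N M (Suc r') u v \<noteq> 0"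
      by blast
    then show ?thesis unfolding Suc .
  qed
  then obtain M u v where M: "M \<in> S" and minor: "gram_minor N M r u v \<noteq> 0" by blast
  let ?A = "mat r r (\<lambda>(i, j). bilin N M (u i) (v j))"
  obtain B where B: "B \<in> carrier_mat r r" and AB: "?A * B = 1\<^sub>m r"
    using det_non_zero_imp_unit[of ?A r "()"] minor
    by (auto simp: Units_def ring_mat_def)
  have AB': "(\<Sum>j<r. bilin N M (u i) (v j) * B $$ (j, s)) = (if i = s then 1 else 0)"
    if "i < r" "s < r" for i s
    using arg_cong[OF AB, of "\<lambda>C. C $$ (i, s)"] that B
    by (auto simp: scalar_prod_def lessThan_atLeast0)
  define e :: "nat \<Rightarrow> nat \<Rightarrow> 'a" where "e c a = (if a = c then 1 else 0)" for c a
  \<comment> \<open>The coefficients of the \<open>v\<^sub>j\<close> are chosen, via the inverse \<open>B\<close> of the Gram matrix, such that \<open>P c\<close>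
    becomes orthogonal to all \<open>u\<^sub>i\<close>.\<close>
  define l where "l j c = (\<Sum>s<r. B $$ (j, s) * bilin N M (u s) (e c))" for j c
  define P where "P c a = e c a - (\<Sum>j<r. l j c * v j a)" for c a
  have "bilin N M (u i) (P c) = 0" if "i < r" for i c
  proof -
    have "bilin N M (u i) (P c) =
        bilin N M (u i) (e c) - (\<Sum>j<r. l j c * bilin N M (u i) (v j))"
      unfolding P_def[abs_def] by (simp add: bilin_diff_right bilin_sum_right bilin_scale_right)
    also have "(\<Sum>j<r. l j c * bilin N M (u i) (v j)) =
        (\<Sum>j<r. \<Sum>s<r. bilin N M (u s) (e c) * (bilin N M (u i) (v j) * B $$ (j, s)))"
      by (simp add: l_def sum_distrib_right sum_distrib_left ac_simps)
    also have "\<dots> = (\<Sum>s<r. bilin N M (u s) (e c) * (\<Sum>j<r. bilin N M (u i) (v j) * B $$ (j, s)))"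
      by (subst sum.swap) (simp add: sum_distrib_left)
    also have "\<dots> = (\<Sum>s<r. if s = i then bilin N M (u s) (e c) else 0)"
      by (rule sum.cong) (use that AB' in auto)
    also have "\<dots> = bilin N M (u i) (e c)" using that by simp
    finally show ?thesis by simp
  qed
  then have ker: "bilin N M x (P c) = 0" for x c
    using kernel_of_maximal_minor[OF minor] r M by blast
  have "bilin N A (P c) (P d) = 0" if "A \<in> S" for A c d
    by (rule bounded_rank_vanishes_on_kernel[OF inf sym[OF M] minor])
      (use r line[OF M that] ker in auto)
  moreover have "P c a = (if a = c then 1 else 0) - (\<Sum>j<r. l j c * v j a)" for a c
    by (simp add: P_def e_def)
  ultimately show ?thesis using \<open>r \<le> n\<close> by blast
qed

section \<open>Forms\<close>

lemma monom_degree_superset: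
  assumes "finite A" "Poly_Mapping.keys m \<subseteq> A"
  shows "monom_degree m = (\<Sum>i\<in>A. Poly_Mapping.lookup m i)"
  unfolding monom_degree_def using assms
  by (intro sum.mono_neutral_left) (auto simp: in_keys_iff)

lemma monom_degree_add: "monom_degree (m + n) = monom_degree m + monom_degree n"
proof -
  let ?A = "Poly_Mapping.keys m \<union> Poly_Mapping.keys n"
  have "Poly_Mapping.keys (m + n) \<subseteq> ?A" by (rule keys_add)
  then show ?thesis
    by (subst (1 2 3) monom_degree_superset[of ?A]) (auto simp: lookup_add sum.distrib)
qed

lemma monom_degree_single: "monom_degree (Poly_Mapping.single i k) = k"
  by (simp add: monom_degree_def)

lemma formsI:
  assumes "\<And>m. m \<in> Poly_Mapping.keys F \<Longrightarrow> Poly_Mapping.keys m \<subseteq> {..<N} \<and> monom_degree m = d"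
  shows "F \<in> forms N d"
  using assms by (auto simp: forms_def polys_def)

lemma formsD:
  assumes "F \<in> forms N d" "m \<in> Poly_Mapping.keys F"
  shows "Poly_Mapping.keys m \<subseteq> {..<N}" "monom_degree m = d"
  using assms by (auto simp: forms_def polys_def)

lemma forms_zero [simp]: "0 \<in> forms N d"
  by (rule formsI) simp

lemma forms_add: "F \<in> forms N d \<Longrightarrow> G \<in> forms N d \<Longrightarrow> F + G \<in> forms N d"
  using keys_add[of F G] by (intro formsI) (blast dest: formsD)

lemma forms_sum: "(\<And>i. i \<in> I \<Longrightarrow> F i \<in> forms N d) \<Longrightarrow> sum F I \<in> forms N d"
  by (induction I rule: infinite_finite_induct) (auto intro: forms_add)

lemma forms_mult:
  assumes "F \<in> forms N d" "G \<in> forms N e"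
  shows "F * G \<in> forms N (d + e)"
proof (rule formsI)
  fix m assume "m \<in> Poly_Mapping.keys (F * G)"
  then obtain a b where "m = a + b" "a \<in> Poly_Mapping.keys F" "b \<in> Poly_Mapping.keys G"
    using keys_mult[of F G] by blast
  then show "Poly_Mapping.keys m \<subseteq> {..<N} \<and> monom_degree m = d + e"
    using formsD[OF assms(1), of a] formsD[OF assms(2), of b] keys_add[of a b]
    by (simp add: monom_degree_add) blast
qed

lemma total_degree_form:
  assumes "F \<in> forms N d" "F \<noteq> 0"
  shows "total_degree F = d"
proof -
  have "Poly_Mapping.keys F \<noteq> {}" using assms(2) by simp
  moreover have "monom_degree ` Poly_Mapping.keys F = (\<lambda>_. d) ` Poly_Mapping.keys F"
    using formsD(2)[OF assms(1)] by (rule image_cong[OF refl])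
  ultimately have "monom_degree ` Poly_Mapping.keys F = {d}" by (simp add: image_constant_conv)
  then show ?thesis by (simp add: total_degree_def)
qed

abbreviation Const :: "'a::zero \<Rightarrow> 'a mpoly" where "Const \<equiv> Poly_Mapping.single 0"

abbreviation expo :: "nat \<Rightarrow> nat \<Rightarrow>\<^sub>0 nat" where "expo i \<equiv> Poly_Mapping.single i 1"

abbreviation Var :: "nat \<Rightarrow> 'a::zero_neq_one mpoly" where "Var i \<equiv> Poly_Mapping.single (expo i) 1"

lemma Const_forms: "Const c \<in> forms N 0"
  by (rule formsI) (auto simp: monom_degree_def split: if_splits)

lemma Var_forms: "i < N \<Longrightarrow> Var i \<in> forms N 1"
  by (rule formsI) (auto simp: monom_degree_single split: if_splits)

lemma Const_mult_forms: "F \<in> forms N d \<Longrightarrow> Const c * F \<in> forms N d"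
  using forms_mult[OF Const_forms] by fastforce

lemma Const_sum: "Const (sum f I) = (\<Sum>i\<in>I. Const (f i))"
  by (induction I rule: infinite_finite_induct) (auto simp: single_add)

lemma mpoly_as_sum_of_terms:
  "F = (\<Sum>m\<in>Poly_Mapping.keys F. Poly_Mapping.single m (Poly_Mapping.lookup F m))"
  by (rule poly_mapping_eqI) (auto simp: lookup_sum lookup_single when_def in_keys_iff)

lemma lookup_Const_mult:
  fixes F :: "'a::comm_ring_1 mpoly"
  shows "Poly_Mapping.lookup (Const c * F) m = c * Poly_Mapping.lookup F m"
proof -
  have "Const c * F = (\<Sum>m\<in>Poly_Mapping.keys F. Poly_Mapping.single m (c * Poly_Mapping.lookup F m))"
    by (subst (1) mpoly_as_sum_of_terms) (simp add: sum_distrib_left mult_single)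
  then show ?thesis
    by (auto simp: lookup_sum lookup_single when_def in_keys_iff)
qed

section \<open>Partial derivatives\<close>

lemma diff_expo_add:
  assumes "Poly_Mapping.lookup m i \<noteq> 0"
  shows "expo i + (m - expo i) = m"
  using assms by (intro poly_mapping_eqI) (auto simp: lookup_add lookup_minus lookup_single when_def)

lemma lookup_partial_deriv:
  "Poly_Mapping.lookup (partial_deriv i F) n =
     of_nat (Suc (Poly_Mapping.lookup n i)) * Poly_Mapping.lookup F (n + expo i)"
proof -
  have "(of_nat (Poly_Mapping.lookup m i) * Poly_Mapping.lookup F m when m - expo i = n) =
      (if m = n + expo i then of_nat (Poly_Mapping.lookup m i) * Poly_Mapping.lookup F m else 0)" for m
  proof (cases "Poly_Mapping.lookup m i = 0")
    case False
    then show ?thesis using diff_expo_add[of m i] by (auto simp: when_def add.commute)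
  next
    case True
    then have "of_nat (Poly_Mapping.lookup m i) * Poly_Mapping.lookup F m = 0" by simp
    then show ?thesis by (auto simp: when_def)
  qed
  then show ?thesis
    by (simp add: partial_deriv_def lookup_sum lookup_single in_keys_iff lookup_add)
qed

lemma partial_deriv_forms:
  assumes "F \<in> forms N (Suc d)"
  shows "partial_deriv i F \<in> forms N d"
proof (rule formsI)
  fix n assume "n \<in> Poly_Mapping.keys (partial_deriv i F)"
  then have "n + expo i \<in> Poly_Mapping.keys F"
    by (auto simp: in_keys_iff lookup_partial_deriv)
  note * = formsD[OF assms this]
  have "Poly_Mapping.keys n \<subseteq> Poly_Mapping.keys (n + expo i)"
    by (auto simp: in_keys_iff lookup_add)
  then show "Poly_Mapping.keys n \<subseteq> {..<N} \<and> monom_degree n = d"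
    using * by (auto simp: monom_degree_add monom_degree_single)
qed

text \<open>
  A monomial \<open>m\<close> is reproduced by \<open>x\<^sub>i \<partial>/\<partial>x\<^sub>i\<close> with the factor \<open>m\<^sub>i\<close>, and these factors add up
  to the degree.
\<close>

lemma Euler_identity:
  assumes "F \<in> forms N d"
  shows "(\<Sum>i<N. Var i * partial_deriv i F) = Const (of_nat d) * F"
proof -
  have "Var i * partial_deriv i F =
      (\<Sum>m\<in>Poly_Mapping.keys F.
        Poly_Mapping.single m (of_nat (Poly_Mapping.lookup m i) * Poly_Mapping.lookup F m))" for i
    unfolding partial_deriv_def sum_distrib_left
  proof (rule sum.cong[OF refl])
    fix m assume "m \<in> Poly_Mapping.keys F"
    show "Var i * Poly_Mapping.single (m - expo i)
        (of_nat (Poly_Mapping.lookup m i) * Poly_Mapping.lookup F m) =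
      Poly_Mapping.single m (of_nat (Poly_Mapping.lookup m i) * Poly_Mapping.lookup F m)"
      using diff_expo_add[of m i]
      by (cases "Poly_Mapping.lookup m i = 0") (simp_all add: mult_single)
  qed
  then have "(\<Sum>i<N. Var i * partial_deriv i F) =
      (\<Sum>m\<in>Poly_Mapping.keys F. \<Sum>i<N.
        Poly_Mapping.single m (of_nat (Poly_Mapping.lookup m i) * Poly_Mapping.lookup F m))"
    by (simp add: sum.swap[of _ "{..<N}"])
  also have "\<dots> = (\<Sum>m\<in>Poly_Mapping.keys F.
      Const (of_nat d) * Poly_Mapping.single m (Poly_Mapping.lookup F m))"
  proof (rule sum.cong[OF refl])
    fix m assume m: "m \<in> Poly_Mapping.keys F"
    have "(\<Sum>i<N. Poly_Mapping.lookup m i) = d"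
      using formsD[OF assms m] monom_degree_superset[of "{..<N}" m] by simp
    then have d: "(\<Sum>i<N. of_nat (Poly_Mapping.lookup m i)) = (of_nat d :: 'a)"
      by (metis of_nat_sum)
    have "(\<Sum>i<N. Poly_Mapping.single m (of_nat (Poly_Mapping.lookup m i) * Poly_Mapping.lookup F m)) =
        Poly_Mapping.single m (\<Sum>i<N. of_nat (Poly_Mapping.lookup m i) * Poly_Mapping.lookup F m)"
      by (rule poly_mapping_eqI) (simp add: lookup_sum lookup_single when_def)
    then show "(\<Sum>i<N. Poly_Mapping.single m (of_nat (Poly_Mapping.lookup m i) * Poly_Mapping.lookup F m)) =
      Const (of_nat d) * Poly_Mapping.single m (Poly_Mapping.lookup F m)"
      by (simp add: mult_single d flip: sum_distrib_right del: single_of_nat)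
  qed
  also have "\<dots> = Const (of_nat d) * F"
    by (subst (2) mpoly_as_sum_of_terms) (simp add: sum_distrib_left)
  finally show ?thesis .
qed

section \<open>Quadrics and their Hessian matrices\<close>

text \<open>
  For a quadric, these are the second partial derivatives \<open>\<partial>\<^sup>2Q/\<partial>x\<^sub>a\<partial>x\<^sub>b\<close>. Reading them off from the
  coefficients makes their linearity in \<open>Q\<close> immediate.
\<close>

definition hessian :: "'a::comm_ring_1 mpoly \<Rightarrow> nat \<Rightarrow> nat \<Rightarrow> 'a" where
  "hessian Q a b = (if a = b then 2 else 1) * Poly_Mapping.lookup Q (expo a + expo b)"

lemma hessian_commute: "hessian Q a b = hessian Q b a"
  by (simp add: hessian_def add.commute)

lemma hessian_add: "hessian (P + Q) a b = hessian P a b + hessian Q a b"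
  by (simp add: hessian_def lookup_add algebra_simps)

lemma hessian_mscale: "hessian (mscale c Q) a b = c * hessian Q a b"
  by (simp add: hessian_def mscale_def lookup_Const_mult)

lemma hessian_sum: "hessian (sum Q I) a b = (\<Sum>i\<in>I. hessian (Q i) a b)"
  by (simp add: hessian_def lookup_sum sum_distrib_left)

lemma linear_form_expansion:
  fixes L :: "'a::comm_ring_1 mpoly"
  assumes "L \<in> forms N 1"
  shows "L = (\<Sum>a<N. Const (Poly_Mapping.lookup L (expo a)) * Var a)"
proof (rule poly_mapping_eqI)
  fix m
  have expo_eq: "Poly_Mapping.single a (Suc 0) = Poly_Mapping.single b (Suc 0) \<longleftrightarrow> a = b" for a b :: nat
    by (metis lookup_single_eq lookup_single_not_eq nat.distinct(1))
  show "Poly_Mapping.lookup L m =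
    Poly_Mapping.lookup (\<Sum>a<N. Const (Poly_Mapping.lookup L (expo a)) * Var a) m"
  proof (cases "\<exists>a<N. m = expo a")
    case True
    then show ?thesis by (auto simp: lookup_sum mult_single lookup_single when_def expo_eq)
  next
    case False
    have "m \<notin> Poly_Mapping.keys L"
    proof
      assume "m \<in> Poly_Mapping.keys L"
      note m = formsD[OF assms this]
      then have "(\<Sum>i<N. Poly_Mapping.lookup m i) = 1"
        using monom_degree_superset[of "{..<N}" m] by simp
      then obtain a where a: "a < N" "Poly_Mapping.lookup m a = 1"
          "\<And>b. b < N \<Longrightarrow> b \<noteq> a \<Longrightarrow> Poly_Mapping.lookup m b = 0"
        using sum_eq_1_iff[of "{..<N}" "Poly_Mapping.lookup m"] by auto
      have "Poly_Mapping.lookup m b = Poly_Mapping.lookup (expo a) b" for b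
        using a m(1) by (cases "b < N") (auto simp: lookup_single when_def in_keys_iff)
      then have "m = expo a" by (intro poly_mapping_eqI)
      then show False using False a(1) by blast
    qed
    moreover have "expo a \<noteq> m" if "a < N" for a using False that by blast
    ultimately show ?thesis
      by (simp add: lookup_sum mult_single lookup_single when_def in_keys_iff)
  qed
qed

lemma expo_add_eq_iff:
  "expo a + expo b = expo c + expo d \<longleftrightarrow> (a = c \<and> b = d) \<or> (a = d \<and> b = c)"
proof
  assume eq: "expo a + expo b = expo c + expo d"
  have "(if a = x then 1 else 0) + (if b = x then 1 else 0) =
      (if c = x then 1 else 0) + (if d = x then (1::nat) else 0)" for x
    using arg_cong[OF eq, of "\<lambda>m. Poly_Mapping.lookup m x"]
    unfolding lookup_add lookup_single when_def .
  from this[of a] this[of b] this[of c] this[of d]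
  show "(a = c \<and> b = d) \<or> (a = d \<and> b = c)" 
    by (cases "a = c"; cases "a = d"; cases "b = c"; cases "b = d") simp_all
qed (auto simp: add.commute)

lemma hessian_product:
  assumes G: "G \<in> forms N 1" and H: "H \<in> forms N 1" and "c < N" "d < N"
  shows "hessian (G * H) c d =
    Poly_Mapping.lookup G (expo c) * Poly_Mapping.lookup H (expo d) +
    Poly_Mapping.lookup H (expo c) * Poly_Mapping.lookup G (expo d)"
proof -
  let ?g = "\<lambda>a. Poly_Mapping.lookup G (expo a)" and ?h = "\<lambda>a. Poly_Mapping.lookup H (expo a)"
  have "hessian (G * H) c d =
      hessian ((\<Sum>a<N. Const (?g a) * Var a) * (\<Sum>b<N. Const (?h b) * Var b)) c d"
    using linear_form_expansion[OF G] linear_form_expansion[OF H] by simp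
  also have "\<dots> = (\<Sum>a<N. \<Sum>b<N. hessian (Poly_Mapping.single (expo a + expo b) (?g a * ?h b)) c d)"
    by (simp add: sum_product mult_single hessian_sum)
  also have "\<dots> = (\<Sum>a<N. \<Sum>b<N. (if a = c then if b = d then ?g a * ?h b else 0 else 0) +
      (if a = d then if b = c then ?g a * ?h b else 0 else 0))"
    by (intro sum.cong refl)
      (simp only: hessian_def lookup_single when_def expo_add_eq_iff, auto)
  also have "\<dots> = ?g c * ?h d + ?g d * ?h c"
  proof -
    have "(\<Sum>b<N. if a = x then if b = y then ?g a * ?h b else 0 else 0) =
        (if a = x then ?g a * ?h y else 0)" if "y < N" for a x y
      using that by simp
    then show ?thesis using assms(3,4) by (simp add: sum.distrib)
  qed
  finally show ?thesis by (simp add: ac_simps)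
qed

lemma quadric_expansion:
  assumes "Q \<in> forms N 2"
  shows "Const 2 * Q = (\<Sum>a<N. \<Sum>b<N. Const (hessian Q a b) * (Var a * Var b))"
proof -
  have "Const 2 * Q = (\<Sum>a<N. Var a * partial_deriv a Q)"
    using Euler_identity[OF assms] by simp
  also have "\<dots> = (\<Sum>a<N. Var a * (\<Sum>b<N. Const (hessian Q a b) * Var b))"
  proof (rule sum.cong[OF refl])
    fix a
    have "partial_deriv a Q \<in> forms N 1"
      using partial_deriv_forms[of Q N 1] assms by (simp add: numeral_2_eq_2)
    moreover have "Poly_Mapping.lookup (partial_deriv a Q) (expo b) = hessian Q a b" for b
      by (simp add: lookup_partial_deriv hessian_def lookup_single when_def add.commute)
    ultimately have "partial_deriv a Q = (\<Sum>b<N. Const (hessian Q a b) * Var b)"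
      using linear_form_expansion[of "partial_deriv a Q" N] by simp
    then show "Var a * partial_deriv a Q = Var a * (\<Sum>b<N. Const (hessian Q a b) * Var b)" by simp
  qed
  finally show ?thesis by (simp add: sum_distrib_left ac_simps)
qed

section \<open>Collapses\<close>

text \<open>
  In a collapse of a quadric all factors of nonzero terms are linear forms \<open>g\<close> and \<open>h\<close>, and
  the Hessian matrix of \<open>g h\<close> is the sum \<open>g h\<^sup>T + h g\<^sup>T\<close> of two matrices of rank one.
\<close>

lemma collapse_hessian_factorisation:
  fixes Q :: "'a::comm_ring_1 mpoly"
  assumes Q: "Q \<in> forms N 2" and "has_collapse N k Q"
  shows "\<exists>p q. \<forall>c<N. \<forall>d<N. hessian Q c d = (\<Sum>s<2*k. p s c * q s d)"
proof -
  obtain G H where QGH: "Q = (\<Sum>i<k. G i * H i)"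
    and GH: "\<And>i. i < k \<Longrightarrow> (G i = 0 \<or> G i \<in> forms N (total_degree (G i)) \<and>
        0 < total_degree (G i) \<and> total_degree (G i) < total_degree Q) \<and>
      H i \<in> forms N (total_degree Q - total_degree (G i))"
    using assms(2) unfolding has_collapse_def by blast
  have linear: "G i \<in> forms N 1 \<and> H i \<in> forms N 1" if "i < k" "G i \<noteq> 0" for i
  proof -
    have "G i \<in> forms N (total_degree (G i))" "0 < total_degree (G i)"
        "total_degree (G i) < total_degree Q" "H i \<in> forms N (total_degree Q - total_degree (G i))"
      using GH[OF that(1)] that(2) by auto
    moreover from this(3) have "Q \<noteq> 0" by (auto simp: total_degree_def)
    then have "total_degree Q = 2" by (rule total_degree_form[OF Q])
    ultimately show ?thesis by (auto simp: less_2_cases_iff)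
  qed
  define g where "g i c = Poly_Mapping.lookup (G i) (expo c)" for i c
  define h where "h i c = Poly_Mapping.lookup (H i) (expo c)" for i c
  \<comment> \<open>Term \<open>i\<close> of the collapse contributes the two rank-one matrices with indices \<open>2i\<close> and \<open>2i + 1\<close>.\<close>
  define p where "p s = (if even s then g (s div 2) else h (s div 2))" for s
  define q where "q s = (if even s then h (s div 2) else g (s div 2))" for s
  have pq: "(\<Sum>s<2*k. p s c * q s d) = (\<Sum>i<k. g i c * h i d + h i c * g i d)" for c d
    by (induction k) (simp_all add: p_def q_def)
  have "hessian Q c d = (\<Sum>s<2*k. p s c * q s d)" if "c < N" "d < N" for c d
    unfolding pq QGH hessian_sum
  proof (rule sum.cong[OF refl])
    fix i assume "i \<in> {..<k}"
    then have i: "i < k" by simp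
    show "hessian (G i * H i) c d = g i c * h i d + h i c * g i d"
    proof (cases "G i = 0")
      case True
      then show ?thesis by (simp add: g_def hessian_def)
    next
      case False
      then show ?thesis
        using hessian_product[of "G i" N "H i" c d] linear[OF i False] that by (simp add: g_def h_def)
    qed
  qed
  then show ?thesis by blast
qed

lemma collapse_gram_minor_zero:
  fixes Q :: "'a::idom mpoly"
  assumes "Q \<in> forms N 2" and "has_collapse N k Q"
  shows "gram_minor N (hessian Q) (Suc (2 * k)) u v = 0"
proof -
  obtain p q where pq: "\<And>c d. c < N \<Longrightarrow> d < N \<Longrightarrow> hessian Q c d = (\<Sum>s<2*k. p s c * q s d)"
    using collapse_hessian_factorisation[OF assms] by blast
  have "bilin N (hessian Q) x y = (\<Sum>s<2*k. (\<Sum>c<N. p s c * x c) * (\<Sum>d<N. q s d * y d))" for x y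
  proof -
    have "bilin N (hessian Q) x y = (\<Sum>c<N. \<Sum>d<N. \<Sum>s<2*k. (p s c * x c) * (q s d * y d))"
      unfolding bilin_def by (intro sum.cong refl) (simp add: pq sum_distrib_left sum_distrib_right ac_simps)
    also have "\<dots> = (\<Sum>c<N. \<Sum>s<2*k. \<Sum>d<N. (p s c * x c) * (q s d * y d))"
      by (intro sum.cong refl sum.swap)
    also have "\<dots> = (\<Sum>s<2*k. \<Sum>c<N. \<Sum>d<N. (p s c * x c) * (q s d * y d))"
      by (rule sum.swap)
    finally show ?thesis by (simp add: sum_product)
  qed
  then show ?thesis
    using fdet_low_rank[of "2 * k" "Suc (2 * k)" "\<lambda>s i. \<Sum>c<N. p s c * u i c" "\<lambda>s j. \<Sum>d<N. q s d * v j d"]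
    by simp
qed

text \<open>
  Vanishing \<open>L\<^sub>j\<close> get the cofactor \<open>0\<close>, since the cofactor of a zero factor must be a form of
  degree 3; the list of terms is padded with zeros to length \<open>n\<close>.
\<close>

lemma collapse_from_linear_forms:
  fixes F :: "'a::comm_ring_1 mpoly"
  assumes F: "F \<in> forms N 3" and "r \<le> n"
    and L: "\<And>j. L j \<in> forms N 1" and H: "\<And>j. H j \<in> forms N 2"
    and sum: "F = (\<Sum>j<r. L j * H j)"
  shows "has_collapse N n F"
proof (cases "F = 0")
  case True
  then show ?thesis unfolding has_collapse_def by (intro exI[of _ "\<lambda>_. 0"]) auto
next
  case False
  then have deg: "total_degree F = 3" by (rule total_degree_form[OF F])
  define G where "G j = (if j < r then L j else 0)" for j
  define H' where "H' j = (if G j = 0 then 0 else H j)" for j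
  have "(\<Sum>j<n. G j * H' j) = (\<Sum>j<r. L j * H j)"
    using \<open>r \<le> n\<close> by (intro sum.mono_neutral_cong_right) (auto simp: G_def H'_def)
  moreover have "(G j = 0 \<or> G j \<in> forms N (total_degree (G j)) \<and>
      0 < total_degree (G j) \<and> total_degree (G j) < total_degree F) \<and>
      H' j \<in> forms N (total_degree F - total_degree (G j))" for j
  proof (cases "G j = 0")
    case True
    then show ?thesis by (simp add: H'_def)
  next
    case False
    then have "G j \<in> forms N 1" using L by (auto simp: G_def split: if_splits)
    then show ?thesis using False total_degree_form[of "G j" N 1] H by (simp add: deg H'_def)
  qed
  ultimately show ?thesis
    unfolding has_collapse_def by (intro exI[of _ G] exI[of _ H']) (simp add: sum)
qed

text \<open>
  Write \<open>x\<^sub>a = y\<^sub>a + d\<^sub>a\<close>, where \<open>y\<^sub>a\<close> are the coordinates of the projected point and \<open>d\<^sub>a\<close> is a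
  combination of the linear forms \<open>l\<^sub>j\<close>. In \<open>2Q = \<Sum>\<^sub>a\<^sub>b M\<^sub>a\<^sub>b x\<^sub>a x\<^sub>b\<close> the part in the \<open>y\<^sub>a\<close> alone
  vanishes because the image of the projection is isotropic. What remains,
  \<open>x\<^sub>a x\<^sub>b - y\<^sub>a y\<^sub>b = d\<^sub>a x\<^sub>b + y\<^sub>a d\<^sub>b\<close>, lies in the ideal generated by the \<open>l\<^sub>j\<close>. The cofactors depend
  on \<open>Q\<close>, but the linear forms do not.
\<close>

lemma isotropic_projection_quadric:
  fixes Q :: "'a::comm_ring_1 mpoly"
  assumes Q: "Q \<in> forms N 2"
    and P: "\<And>a c. P c a = (if a = c then 1 else 0) - (\<Sum>j<r. l j c * v j a)"
    and iso: "\<And>c d. c < N \<Longrightarrow> d < N \<Longrightarrow> bilin N (hessian Q) (P c) (P d) = 0"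
  shows "\<exists>H. (\<forall>j. H j \<in> forms N 1) \<and>
    Const 2 * Q = (\<Sum>j<r. (\<Sum>c<N. Const (l j c) * Var c) * H j)"
proof -
  let ?M = "\<lambda>a b. Const (hessian Q a b)"
  define L where "L j = (\<Sum>c<N. Const (l j c) * Var c)" for j
  define Y where "Y a = (\<Sum>c<N. Const (P c a) * Var c)" for a
  define D where "D a = (\<Sum>j<r. Const (v j a) * L j)" for a
  define H where "H j = (\<Sum>a<N. \<Sum>b<N. ?M a b * (Const (v j a) * Var b + Const (v j b) * Y a))" for j
  have monomial: "Const x * (Const y * f * (Const z * g)) = Const (x * y * z) * (f * g)"
    for x y z and f g :: "'a mpoly"
  proof -
    have "Const (x * y * z) = Const x * Const y * Const z" by (simp add: mult_single)
    then show ?thesis by (simp only: ac_simps)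
  qed
  have split: "Var a = Y a + D a" if "a < N" for a
  proof -
    have "D a = (\<Sum>j<r. \<Sum>c<N. Const (v j a) * (Const (l j c) * Var c))"
      by (simp add: D_def L_def sum_distrib_left)
    also have "\<dots> = (\<Sum>c<N. \<Sum>j<r. Const (v j a) * (Const (l j c) * Var c))" by (rule sum.swap)
    also have "\<dots> = (\<Sum>c<N. Const (\<Sum>j<r. l j c * v j a) * Var c)"
      unfolding Const_sum sum_distrib_right
      by (intro sum.cong refl) (simp add: mult_single mult.commute flip: mult.assoc)
    finally have "Y a + D a = (\<Sum>c<N. Const (P c a + (\<Sum>j<r. l j c * v j a)) * Var c)"
      by (simp add: Y_def single_add distrib_right sum.distrib)
    also have "\<dots> = (\<Sum>c<N. if c = a then Var c else 0)"
      by (rule sum.cong[OF refl]) (auto simp: P mult_single)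
    finally show ?thesis using that by simp
  qed
  have YY: "(\<Sum>a<N. \<Sum>b<N. ?M a b * (Y a * Y b)) = 0"
  proof -
    have "(\<Sum>a<N. \<Sum>b<N. ?M a b * (Y a * Y b)) =
        (\<Sum>a<N. \<Sum>b<N. \<Sum>c<N. \<Sum>d<N. Const (hessian Q a b * P c a * P d b) * (Var c * Var d))"
      unfolding Y_def unfolding sum_product unfolding sum_distrib_left monomial ..
    also have "\<dots> = (\<Sum>a<N. \<Sum>c<N. \<Sum>b<N. \<Sum>d<N. Const (hessian Q a b * P c a * P d b) * (Var c * Var d))"
      by (intro sum.cong refl sum.swap)
    also have "\<dots> = (\<Sum>c<N. \<Sum>a<N. \<Sum>b<N. \<Sum>d<N. Const (hessian Q a b * P c a * P d b) * (Var c * Var d))"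
      by (rule sum.swap)
    also have "\<dots> = (\<Sum>c<N. \<Sum>a<N. \<Sum>d<N. \<Sum>b<N. Const (hessian Q a b * P c a * P d b) * (Var c * Var d))"
      by (intro sum.cong refl sum.swap)
    also have "\<dots> = (\<Sum>c<N. \<Sum>d<N. \<Sum>a<N. \<Sum>b<N. Const (hessian Q a b * P c a * P d b) * (Var c * Var d))"
      by (intro sum.cong refl sum.swap)
    also have "\<dots> = (\<Sum>c<N. \<Sum>d<N. Const (bilin N (hessian Q) (P c) (P d)) * (Var c * Var d))"
      unfolding bilin_def Const_sum sum_distrib_right ..
    finally show ?thesis by (simp add: iso)
  qed
  have "Const 2 * Q = (\<Sum>a<N. \<Sum>b<N. ?M a b * (Var a * Var b))"
    by (rule quadric_expansion[OF Q])
  also have "\<dots> = (\<Sum>a<N. \<Sum>b<N. ?M a b * (Y a * Y b) + ?M a b * (D a * Var b + Y a * D b))"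
  proof (intro sum.cong refl)
    fix a b assume "a \<in> {..<N}" "b \<in> {..<N}"
    then have ab: "Var a = Y a + D a" "Var b = Y b + D b" using split by auto
    show "?M a b * (Var a * Var b) = ?M a b * (Y a * Y b) + ?M a b * (D a * Var b + Y a * D b)"
      unfolding ab by (simp add: algebra_simps)
  qed
  also have "\<dots> = (\<Sum>a<N. \<Sum>b<N. ?M a b * (D a * Var b + Y a * D b))"
    by (simp add: sum.distrib YY)
  also have "\<dots> = (\<Sum>a<N. \<Sum>b<N. \<Sum>j<r. L j * (?M a b * (Const (v j a) * Var b + Const (v j b) * Y a)))"
  proof (intro sum.cong refl)
    fix a b
    have "D a * Var b + Y a * D b = (\<Sum>j<r. L j * (Const (v j a) * Var b + Const (v j b) * Y a))"
      unfolding D_def sum_distrib_left sum_distrib_right sum.distrib[symmetric]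
      by (intro sum.cong refl) (simp only: distrib_left ac_simps)
    then show "?M a b * (D a * Var b + Y a * D b) =
        (\<Sum>j<r. L j * (?M a b * (Const (v j a) * Var b + Const (v j b) * Y a)))"
      by (simp only: sum_distrib_left mult.left_commute[of "L _"])
  qed
  also have "\<dots> = (\<Sum>a<N. \<Sum>j<r. \<Sum>b<N. L j * (?M a b * (Const (v j a) * Var b + Const (v j b) * Y a)))"
    by (intro sum.cong refl sum.swap)
  also have "\<dots> = (\<Sum>j<r. \<Sum>a<N. \<Sum>b<N. L j * (?M a b * (Const (v j a) * Var b + Const (v j b) * Y a)))"
    by (rule sum.swap)
  also have "\<dots> = (\<Sum>j<r. L j * H j)"
    by (simp only: H_def sum_distrib_left)
  finally have "Const 2 * Q = (\<Sum>j<r. L j * H j)" .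
  moreover have "H j \<in> forms N 1" for j
    unfolding H_def Y_def
    by (intro forms_sum Const_mult_forms forms_add Var_forms) auto
  ultimately show ?thesis unfolding L_def by blast
qed

text \<open>
  By Euler's identity \<open>6F = \<Sum>\<^sub>i x\<^sub>i (2 \<partial>F/\<partial>x\<^sub>i)\<close>, so \<open>F\<close> lies in the ideal generated by the \<open>r\<close>
  linear forms that serve all partial derivatives simultaneously.
\<close>

lemma cubic_collapse_from_partials:
  fixes F :: "'a::field mpoly"
  assumes F: "F \<in> forms N 3" and char: "(2::'a) \<noteq> 0" "(3::'a) \<noteq> 0" and "r \<le> n"
    and P: "\<And>a c. P c a = (if a = c then 1 else 0) - (\<Sum>j<r. l j c * v j a)"
    and iso: "\<And>i c d. i < N \<Longrightarrow> c < N \<Longrightarrow> d < N \<Longrightarrow>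
      bilin N (hessian (partial_deriv i F)) (P c) (P d) = 0"
  shows "has_collapse N n F"
proof -
  define L where "L j = (\<Sum>c<N. Const (l j c) * Var c)" for j
  have "\<exists>H. (\<forall>j. H j \<in> forms N 1) \<and> Const 2 * partial_deriv i F = (\<Sum>j<r. L j * H j)"
    if "i < N" for i
    unfolding L_def
  proof (rule isotropic_projection_quadric[OF _ P iso[OF that]])
    show "partial_deriv i F \<in> forms N 2"
      by (rule partial_deriv_forms) (use F in \<open>simp add: numeral_3_eq_3 numeral_2_eq_2\<close>)
  qed
  then obtain H where H: "\<And>i j. i < N \<Longrightarrow> H i j \<in> forms N 1"
    and part: "\<And>i. i < N \<Longrightarrow> Const 2 * partial_deriv i F = (\<Sum>j<r. L j * H i j)"
    by metis
  define H' where "H' j = Const (inverse 6) * (\<Sum>i<N. Var i * H i j)" for j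
  have "(6::'a) = 2 * 3" by simp
  then have "(6::'a) \<noteq> 0" using char by (metis mult_eq_0_iff)
  then have "inverse 6 * (2 * 3) = (1::'a)" by simp
  then have one: "Const (inverse 6) * (Const 2 * Const 3) = (1 :: 'a mpoly)"
    unfolding mult_single by simp
  have "F = (Const (inverse 6) * (Const 2 * Const 3)) * F" unfolding one by simp
  also have "\<dots> = Const (inverse 6) * (Const 2 * (Const 3 * F))" by (simp only: mult.assoc)
  also have "Const 3 * F = (\<Sum>i<N. Var i * partial_deriv i F)"
    using Euler_identity[OF F] by simp
  also have "Const 2 * \<dots> = (\<Sum>i<N. Var i * (Const 2 * partial_deriv i F))"
    unfolding sum_distrib_left mult.left_commute[of "Const 2"] ..
  also have "\<dots> = (\<Sum>i<N. Var i * (\<Sum>j<r. L j * H i j))"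
    by (rule sum.cong[OF refl]) (simp only: part lessThan_iff)
  also have "\<dots> = (\<Sum>j<r. \<Sum>i<N. L j * (Var i * H i j))"
    unfolding sum_distrib_left mult.left_commute[of "Var _"] by (rule sum.swap)
  also have "Const (inverse 6) * \<dots> = (\<Sum>j<r. L j * H' j)"
    unfolding H'_def sum_distrib_left mult.left_commute[of "Const (inverse 6)"] ..
  finally have sum: "F = (\<Sum>j<r. L j * H' j)" .
  have L: "L j \<in> forms N 1" for j
    unfolding L_def by (intro forms_sum Const_mult_forms Var_forms) auto
  have H': "H' j \<in> forms N 2" for j
    unfolding H'_def
  proof (intro Const_mult_forms forms_sum)
    fix i assume "i \<in> {..<N}"
    then have i: "i < N" by simp
    show "Var i * H i j \<in> forms N 2"
      using forms_mult[OF Var_forms[OF i] H[OF i]] by (simp only: one_add_one)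
  qed
  show ?thesis by (rule collapse_from_linear_forms[OF F \<open>r \<le> n\<close> L H' sum])
qed

section \<open>Principal open sets in the Zariski topology\<close>

lemma polynomial_functions_sum:
  "(\<And>i. i \<in> I \<Longrightarrow> f i \<in> polynomial_functions V) \<Longrightarrow> (\<lambda>x. \<Sum>i\<in>I. f i x) \<in> polynomial_functions V"
  by (induction I rule: infinite_finite_induct)
    (auto intro: polynomial_functions.const polynomial_functions.add)

lemma polynomial_functions_prod:
  "(\<And>i. i \<in> I \<Longrightarrow> f i \<in> polynomial_functions V) \<Longrightarrow> (\<lambda>x. \<Prod>i\<in>I. f i x) \<in> polynomial_functions V"
  by (induction I rule: infinite_finite_induct)
    (auto intro: polynomial_functions.const polynomial_functions.mult)

lemma polynomial_functions_fdet:
  "(\<And>i j. (\<lambda>x. f x i j) \<in> polynomial_functions V) \<Longrightarrow> (\<lambda>x. fdet n (f x)) \<in> polynomial_functions V"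
  unfolding fdet_Leibniz
  by (intro polynomial_functions_sum polynomial_functions.mult polynomial_functions.const
      polynomial_functions_prod)

lemma polynomial_function_on_line:
  assumes "f \<in> polynomial_functions V" and V: "mpoly.subspace V" and u: "u \<in> V" and w: "w \<in> V"
  shows "\<exists>p. \<forall>t. f (u + mscale t w) = poly p t"
  using assms(1)
proof induction
  case (const c)
  show ?case by (rule exI[of _ "[:c:]"]) simp
next
  case (linear f)
  have "f (u + mscale t w) = poly [:f u, f w:] t" for t
    using linear u w mpoly.subspace_scale[OF V w] by simp
  then show ?case by blast
next
  case (add f g)
  then obtain p q where "\<forall>t. f (u + mscale t w) = poly p t" "\<forall>t. g (u + mscale t w) = poly q t" by blast
  then show ?case by (intro exI[of _ "p + q"]) simp
next
  case (mult f g)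
  then obtain p q where "\<forall>t. f (u + mscale t w) = poly p t" "\<forall>t. g (u + mscale t w) = poly q t" by blast
  then show ?case by (intro exI[of _ "p * q"]) simp
qed

lemma openin_zariski_nonvanishing:
  assumes "f \<in> polynomial_functions V"
  shows "openin (zariski_topology V) {v \<in> V. f v \<noteq> 0}"
  unfolding openin_zariski zariski_closed_def
  using assms by (intro conjI exI[of _ "{f}"]) auto

text \<open>
  Let \<open>u\<close> be a point of a nonempty open set, and let the polynomial function \<open>g\<close> vanish off that set
  but not at \<open>u\<close>. Restrict \<open>f\<close> and \<open>g\<close> to the line through \<open>u\<close> and \<open>w\<close>. Both restrictions are nonzero
  polynomials in one variable, so over an infinite field their product is nonzero somewhere on the
  line.
\<close>

lemma dense_zariski_nonvanishing:
  fixes V :: "'a::field mpoly set"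
  assumes inf: "infinite (UNIV :: 'a set)" and V: "mpoly.subspace V"
    and f: "f \<in> polynomial_functions V" and w: "w \<in> V" "f w \<noteq> 0"
  shows "zariski_topology V closure_of {v \<in> V. f v \<noteq> 0} = V"
proof (rule antisym)
  show "zariski_topology V closure_of {v \<in> V. f v \<noteq> 0} \<subseteq> V"
    using closure_of_subset_topspace[of "zariski_topology V"] by (simp add: topspace_zariski)
  show "V \<subseteq> zariski_topology V closure_of {v \<in> V. f v \<noteq> 0}"
  proof
    fix u assume u: "u \<in> V"
    have "\<exists>y\<in>{v \<in> V. f v \<noteq> 0}. y \<in> T" if "u \<in> T" and T: "openin (zariski_topology V) T" for T
    proof -
      obtain R where R: "R \<subseteq> polynomial_functions V" "V - T = {v \<in> V. \<forall>f\<in>R. f v = 0}"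
        using T unfolding openin_zariski zariski_closed_def by blast
      obtain g where g: "g \<in> R" "g u \<noteq> 0" using R(2) u \<open>u \<in> T\<close> by blast
      have line: "u + mscale t (w - u) \<in> V" for t
        using V u w by (intro mpoly.subspace_add mpoly.subspace_scale mpoly.subspace_diff)
      have wu: "w - u \<in> V" using V u w by (intro mpoly.subspace_diff)
      obtain p where p: "\<And>t. f (u + mscale t (w - u)) = poly p t"
        using polynomial_function_on_line[OF f V u wu] by blast
      obtain q where q: "\<And>t. g (u + mscale t (w - u)) = poly q t"
        using polynomial_function_on_line[OF _ V u wu] R(1) g(1) by blast
      have "p \<noteq> 0" using p[of 1] w(2) by (auto simp: mscale_def)
      moreover have "q \<noteq> 0" using q[of 0] g(2) by (auto simp: mscale_def)
      ultimately have "p * q \<noteq> 0" by simp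
      then obtain t where "poly (p * q) t \<noteq> 0"
        using poly_eq_0_if_almost_all_roots[OF inf, of "{}" "p * q"] by auto
      then have "f (u + mscale t (w - u)) \<noteq> 0" "g (u + mscale t (w - u)) \<noteq> 0"
        using p q by auto
      then show ?thesis using line[of t] R(2) g(1) by blast
    qed
    then show "u \<in> zariski_topology V closure_of {v \<in> V. f v \<noteq> 0}"
      using u by (simp add: in_closure_of topspace_zariski)
  qed
qed

section \<open>Generic strength of the partial derivatives of a cubic form\<close>

lemma deriv_space_forms:
  assumes "F \<in> forms N (Suc d)" "Q \<in> deriv_space N F"
  shows "Q \<in> forms N d"
  using assms(2) unfolding deriv_space_def
proof (induction rule: mpoly.span_induct_alt)
  case (step c x y)
  then show ?case
    using assms(1) unfolding mscale_def
    by (auto intro!: forms_add Const_mult_forms partial_deriv_forms)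
qed simp

text \<open>
  The open set is the set where one fixed minor of order \<open>2k + 1\<close> of the Hessian matrix does
  not vanish. The strength of \<open>F\<close> is what provides a minor that does not vanish identically on
  the space of derivatives.
\<close>

lemma cubic_generically_strong:
  fixes F :: "'a::field mpoly"
  assumes inf: "infinite (UNIV :: 'a set)" and char: "(2::'a) \<noteq> 0" "(3::'a) \<noteq> 0"
    and F: "F \<in> forms N 3" and strong: "strong N (2 * k) F"
  shows "generically_strong N k F"
proof -
  let ?V = "deriv_space N F"
  let ?minor = "\<lambda>u v Q. gram_minor N (hessian Q) (Suc (2 * k)) u v"
  have V: "mpoly.subspace ?V" by (simp add: deriv_space_def)
  have forms: "Q \<in> forms N 2" if "Q \<in> ?V" for Q
    by (rule deriv_space_forms[OF _ that]) (use F in \<open>simp add: numeral_3_eq_3 numeral_2_eq_2\<close>)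
  have "\<exists>Q\<in>?V. \<exists>u v. ?minor u v Q \<noteq> 0"
  proof (rule ccontr)
    assume "\<not> ?thesis"
    then have zero: "\<And>Q u v. Q \<in> ?V \<Longrightarrow> ?minor u v Q = 0" by blast
    have "\<exists>r\<le>2 * k. \<exists>v l P. (\<forall>a c. P c a = (if a = c then 1 else 0) - (\<Sum>j<r. l j c * v j a)) \<and>
        (\<forall>A\<in>hessian ` ?V. \<forall>c<N. \<forall>d<N. bilin N A (P c) (P d) = 0)"
    proof (rule bounded_rank_common_isotropic_projection[OF inf])
      show "hessian ` ?V \<noteq> {}" using mpoly.subspace_0[OF V] by blast
      show "\<And>M a b. M \<in> hessian ` ?V \<Longrightarrow> M a b = M b a" using hessian_commute by fast
      show "\<And>M u v. M \<in> hessian ` ?V \<Longrightarrow> gram_minor N M (Suc (2 * k)) u v = 0" using zero by fast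
      fix M A t assume "M \<in> hessian ` ?V" "A \<in> hessian ` ?V"
      then obtain P Q where PQ: "M = hessian P" "A = hessian Q" "P \<in> ?V" "Q \<in> ?V" by blast
      then have "P + mscale t Q \<in> ?V"
        using V by (intro mpoly.subspace_add mpoly.subspace_scale)
      moreover have "(\<lambda>a b. M a b + t * A a b) = hessian (P + mscale t Q)"
        by (intro ext) (simp add: PQ hessian_add hessian_mscale)
      ultimately show "(\<lambda>a b. M a b + t * A a b) \<in> hessian ` ?V" by blast
    qed
    then obtain r v l P where "r \<le> 2 * k"
      and P: "\<And>a c. P c a = (if a = c then 1 else 0) - (\<Sum>j<r. l j c * v j a)"
      and iso: "\<And>Q c d. Q \<in> ?V \<Longrightarrow> c < N \<Longrightarrow> d < N \<Longrightarrow> bilin N (hessian Q) (P c) (P d) = 0"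
      by blast
    have "partial_deriv i F \<in> ?V" if "i < N" for i
      unfolding deriv_space_def using that by (intro mpoly.span_base) auto
    then have "has_collapse N (2 * k) F"
      using cubic_collapse_from_partials[OF F char \<open>r \<le> 2 * k\<close> P] iso by blast
    then show False using strong by (simp add: strong_def)
  qed
  then obtain Q\<^sub>0 u v where Q\<^sub>0: "Q\<^sub>0 \<in> ?V" "?minor u v Q\<^sub>0 \<noteq> 0" by blast
  have "?minor u v \<in> polynomial_functions ?V"
  proof (rule polynomial_functions_fdet)
    fix i j
    show "(\<lambda>Q. bilin N (hessian Q) (u i) (v j)) \<in> polynomial_functions ?V"
      by (rule polynomial_functions.linear)
        (simp_all add: bilin_def hessian_add hessian_mscale sum.distrib sum_distrib_left algebra_simps)
  qed
  note f = this
  show ?thesis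
    unfolding generically_strong_def
  proof (intro exI[of _ "{Q \<in> ?V. ?minor u v Q \<noteq> 0}"] conjI ballI)
    show "openin (zariski_topology ?V) {Q \<in> ?V. ?minor u v Q \<noteq> 0}"
      by (rule openin_zariski_nonvanishing[OF f])
    show "zariski_topology ?V closure_of {Q \<in> ?V. ?minor u v Q \<noteq> 0} = ?V"
      by (rule dense_zariski_nonvanishing[OF inf V f Q\<^sub>0])
    fix Q assume "Q \<in> {Q \<in> ?V. ?minor u v Q \<noteq> 0}"
    then show "strong N k Q"
      using collapse_gram_minor_zero[OF forms, of Q k u v] by (auto simp: strong_def)
  qed
qed

theorem theorem1p15:
  assumes "CHAR('a::alg_closed_field) \<noteq> 2" and "CHAR('a) \<noteq> 3"
  shows "(\<forall>N>0. \<forall>k>0. \<forall>F\<in>(forms N 3 :: 'a mpoly set).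
            strong N (2 * k) F \<longrightarrow>
            (\<exists>U. openin (zariski_topology (deriv_space N F)) U \<and>
                 zariski_topology (deriv_space N F) closure_of U = deriv_space N F \<and>
                 (\<forall>Q\<in>U. strong N k Q)))
         \<and> key_function TYPE('a) 3 {p. p \<noteq> 2 \<and> p \<noteq> 3} (\<lambda>k. 2 * k)"
proof -
  have prime_char: "of_nat p \<noteq> (0::'a)" if "prime p" "CHAR('a) \<noteq> p" for p
  proof
    assume "of_nat p = (0::'a)"
    then have "CHAR('a) dvd p" by (simp only: of_nat_eq_0_iff_char_dvd)
    then have "CHAR('a) = 1" using that by (auto simp: prime_nat_iff)
    then show False by simp
  qed
  have char: "(2::'a) \<noteq> 0" "(3::'a) \<noteq> 0"
    using prime_char[OF two_is_prime_nat] prime_char[of 3] assms by simp_all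
  then have "generically_strong N k F"
    if "F \<in> forms N 3" "strong N (2 * k) F" for N k and F :: "'a mpoly"
    using cubic_generically_strong[OF infinite_alg_closed] that by blast
  then show ?thesis
    unfolding key_function_def generically_strong_def by blast
qed

end
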